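(* Let $q\in(0,1)$ and $\alpha,\beta>-1$. The operator $U_q^{\alpha,\beta}$ is self-adjoint for $\langle\cdot,\cdot\rangle_q^{\alpha,\beta}$ on the space of polynomials, that is, $\langle U_q^{\alpha,\beta}f,g\rangle_q^{\alpha,\beta}=\langle f,U_q^{\alpha,\beta}g\rangle_q^{\alpha,\beta}$ for all real polynomials $f,g$. For every $r\in\mathbb N$ it maps the space of polynomials of degree at most $r$ into itself. Consequently, for every $r\in\mathbb N$, $P_{r,q}^{\alpha,\beta}$ is an eigenvector of $U_q^{\alpha,\beta}$ for the eigenvalue $$\mu_r^{\alpha,\beta}=-q^{-\beta-r}[r]_q[r+\alpha+\beta+1]_q.$$
   Context: For real $a$, $[a]_q=\frac{1-q^a}{1-q}$; $[r]_q!=\prod_{j=1}^r[j]_q$. For real $a$, $(1-x)_q^a=\prod_{j=0}^\infty\frac{1-q^jx}{1-q^{j+a}x}$. The $q$-derivative is $D_qh(x)=\frac{h(qx)-h(x)}{(q-1)x}$ for $x\ne0$ (and $D_qh(0)=h'(0)$ for polynomials). Bilinear form: $\langle f,g\rangle_q^{\alpha,\beta}=q^{(\alpha+1)(\beta+1)}(1-q)\sum_{i=0}^\infty q^iq^{i\alpha}(1-q^{i+1})_q^\beta f(q^{i+\beta+1})g(q^{i+\beta+1})$; it is an inner product on the space of polynomials. $(P_{r,q}^{\alpha,\beta})_{r\in\mathbb N}$ is the sequence of orthogonal polynomials for this inner product with $\deg P_{r,q}^{\alpha,\beta}=r$ and $P_{r,q}^{\alpha,\beta}(0)=\frac{[\alpha+r]_q\cdots[\alpha+1]_q}{[r]_q!}$.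 The operator is $$U_q^{\alpha,\beta}f(x)=\frac{D_q\left(x^{\alpha+1}(1-q^{-\beta-1}x)_q^{\beta+1}\,(D_qf)(x/q)\right)}{x^\alpha(1-q^{-\beta}x)_q^\beta},$$ where $D_q$ outside is applied with respect to $x$ to the function $x\mapsto x^{\alpha+1}(1-q^{-\beta-1}x)_q^{\beta+1}(D_qf)(x/q)$. After cancelling common factors (which defines $U_q^{\alpha,\beta}f(x)$ where the quotient is not literally defined) this reads $U_q^{\alpha,\beta}f(x)=\frac{q^{\alpha+1}(1-x)D_qf(x)-(1-q^{-\beta-1}x)(D_qf)(x/q)}{q-1}$. *)

theory Defs
  imports "HOL-Analysis.Infinite_Products" "HOL-Computational_Algebra.Polynomial"
begin

definition q_num :: "real \<Rightarrow> real \<Rightarrow> real" where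
  "q_num q a = (1 - q powr a) / (1 - q)"

definition q_fact :: "real \<Rightarrow> nat \<Rightarrow> real" where
  "q_fact q r = (\<Prod>j = 1..r. q_num q (real j))"

text \<open>\<open>q_pow q a x\<close> is $(1 - x)_q^a$; thus $(1 - cx)_q^a$ is \<open>q_pow q a (c * x)\<close>.\<close>

definition q_pow :: "real \<Rightarrow> real \<Rightarrow> real \<Rightarrow> real" where
  "q_pow q a x = prodinf (\<lambda>j. (1 - q ^ j * x) / (1 - q powr (real j + a) * x))"

definition q_deriv :: "real \<Rightarrow> (real \<Rightarrow> real) \<Rightarrow> real \<Rightarrow> real" where
  "q_deriv q h x = (if x = 0 then deriv h 0 else (h (q * x) - h x) / ((q - 1) * x))"

definition q_inner :: "real \<Rightarrow> real \<Rightarrow> real \<Rightarrow> (real \<Rightarrow> real) \<Rightarrow> (real \<Rightarrow> real) \<Rightarrow> real" where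
  "q_inner q \<alpha> \<beta> f g =
     q powr ((\<alpha> + 1) * (\<beta> + 1)) * (1 - q) *
     (\<Sum>i. q ^ i * q powr (real i * \<alpha>) * q_pow q \<beta> (q ^ (i + 1)) *
            f (q powr (real i + \<beta> + 1)) * g (q powr (real i + \<beta> + 1)))"

definition is_q_orth_seq :: "real \<Rightarrow> real \<Rightarrow> real \<Rightarrow> (nat \<Rightarrow> real poly) \<Rightarrow> bool" where
  "is_q_orth_seq q \<alpha> \<beta> P \<longleftrightarrow>
     (\<forall>r. degree (P r) = r) \<and>
     (\<forall>r s. r \<noteq> s \<longrightarrow> q_inner q \<alpha> \<beta> (poly (P r)) (poly (P s)) = 0) \<and>
     (\<forall>r. poly (P r) 0 = (\<Prod>j = 1..r. q_num q (\<alpha> + real j)) / q_fact q r)"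

definition q_orth_poly :: "real \<Rightarrow> real \<Rightarrow> real \<Rightarrow> nat \<Rightarrow> real poly" where
  "q_orth_poly q \<alpha> \<beta> = (THE P. is_q_orth_seq q \<alpha> \<beta> P)"

text \<open>
  The operator is a quotient, given by \<open>q_op_quotient\<close>, and is continued by \<open>q_op_cancelled\<close> to the
  points where that quotient is not defined. The quotient is defined when $x > 0$ (because of
  the real powers of $x$), no factor $1 - q^j x$ vanishes (these are the denominators of all the
  infinite products involved), and no factor $1 - q^{j-\beta} x$ of the numerator of
  $(1 - q^{-\beta} x)_q^\beta$ vanishes, so that the outer division is legitimate.
\<close>

definition q_op_quotient :: "real \<Rightarrow> real \<Rightarrow> real \<Rightarrow> (real \<Rightarrow> real) \<Rightarrow> real \<Rightarrow> real" where
  "q_op_quotient q \<alpha> \<beta> f x =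
     q_deriv q (\<lambda>y. y powr (\<alpha> + 1) * q_pow q (\<beta> + 1) (q powr (-\<beta> - 1) * y) * q_deriv q f (y / q)) x
       / (x powr \<alpha> * q_pow q \<beta> (q powr (-\<beta>) * x))"

definition q_op_cancelled :: "real \<Rightarrow> real \<Rightarrow> real \<Rightarrow> (real \<Rightarrow> real) \<Rightarrow> real \<Rightarrow> real" where
  "q_op_cancelled q \<alpha> \<beta> f x =
     (q powr (\<alpha> + 1) * (1 - x) * q_deriv q f x
       - (1 - q powr (-\<beta> - 1) * x) * q_deriv q f (x / q)) / (q - 1)"

definition q_op :: "real \<Rightarrow> real \<Rightarrow> real \<Rightarrow> (real \<Rightarrow> real) \<Rightarrow> real \<Rightarrow> real" where
  "q_op q \<alpha> \<beta> f x =
     (if x > 0 \<and> (\<forall>j::nat. 1 - q ^ j * x \<noteq> 0) \<and> (\<forall>j::nat. 1 - q powr (real j - \<beta>) * x \<noteq> 0)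
      then q_op_quotient q \<alpha> \<beta> f x
      else q_op_cancelled q \<alpha> \<beta> f x)"

end

theory Submission imports Defs
begin

text \<open>
  Write $U$ for the operator, $w_i$ for the weight of the inner product at the node
  $x_i = q^{i+\beta+1}$, and $D$ for the $q$-derivative.

  On polynomials the quotient that defines $U$ agrees with its cancelled form, by the rules
  $(1-z)_q^{a+1} = (1-z)_q^a\,(1-q^a z)$ and $(1-z/q)_q^{a+1} = (1-z/q)(1-z)_q^a$ for infinite
  products (\<open>q_op_quotient_eq_cancelled\<close>). From the cancelled form,
  $U x^k = \mu_k x^k + \lambda_k x^{k-1}$ with $\mu_k$ the claimed eigenvalue and
  $\lambda_k = [k]_q[\alpha+k]_q\,q^{1-k}$ (\<open>coeff_q_op_poly\<close>), so $U$ does not raise degrees.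

  Self-adjointness is summation by parts. The weights satisfy the first order recurrence
  $w_{i+1}(1-q^{i+1}) = w_i\,q^{\alpha+1}(1-x_i)$ (\<open>weight_Suc\<close>). It says that
  $w_i\,(Uf)(x_i) = T_i - T_{i-1}$ for the flux
  $T_i = q^{\alpha+1}(1-x_i)\,w_i\,(Df)(x_i)/(q-1)$, with $T_{-1} = 0$. The partial sums of
  $\langle Uf,g\rangle - \langle f,Ug\rangle$ therefore telescope to a boundary term
  (\<open>lagrange_identity\<close>), which vanishes in the limit because $w_i \to 0$.

  The eigenvalues $\mu_r$ are pairwise distinct and the $\lambda_k$ with $k \ge 1$ are nonzero. Hence
  $Up = \mu_r p$ has a solution of degree exactly $r$ with any prescribed nonzero constant term.
  Eigenvectors of a self-adjoint operator for distinct eigenvalues are orthogonal, so these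
  solutions, with the right constant terms, form an orthogonal sequence. The form is positive
  definite on polynomials, so that sequence is the only one (\<open>orth_seq_unique\<close>), and
  $P_{r,q}^{\alpha,\beta}$ is the eigenvector. Constructing the sequence this way yields its
  existence, the condition $P_{r,q}^{\alpha,\beta}(0) \ne 0$ included, together with the eigenvalue
  equation.
\<close>

section \<open>Quotients of infinite q-products\<close>

text \<open>The quotient of q-Pochhammer symbols $(z;q)_\infty/(w;q)_\infty$. Separating $z$ and $w$ turns
  every shift of exponent or argument of $(1-x)_q^a$ into a shift of one of the two by a factor $q$.\<close>

definition q_poch_ratio :: "real \<Rightarrow> real \<Rightarrow> real \<Rightarrow> real" where
  "q_poch_ratio q z w = prodinf (\<lambda>j. (1 - q ^ j * z) / (1 - q ^ j * w))"

lemma q_pow_eq_q_poch_ratio: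
  assumes "0 < q"
  shows "q_pow q a z = q_poch_ratio q z (q powr a * z)"
  using assms by (simp add: q_pow_def q_poch_ratio_def powr_add powr_realpow mult.assoc)

lemma convergent_q_poch_ratio:
  fixes q z w :: real
  assumes q: "0 < q" "q < 1" and nz: "\<And>j::nat. 1 - q ^ j * w \<noteq> 0"
  shows "convergent_prod (\<lambda>j. (1 - q ^ j * z) / (1 - q ^ j * w))"
proof -
  let ?f = "\<lambda>j. (1 - q ^ j * z) / (1 - q ^ j * w)"
  have q_pow0: "(\<lambda>j. q ^ j) \<longlonglongrightarrow> 0" using q by (intro LIMSEQ_realpow_zero) auto
  have "(\<lambda>j. norm (1 - q ^ j * w)) \<longlonglongrightarrow> norm (1 - 0 * w)"
    by (intro tendsto_intros q_pow0)
  then have "\<forall>\<^sub>F j in sequentially. norm (1 - q ^ j * w) > 1/2"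
    by (rule order_tendstoD) simp
  then have "\<forall>\<^sub>F j in sequentially. norm (norm (?f j - 1)) \<le> 2 * \<bar>w - z\<bar> * q ^ j"
  proof eventually_elim
    case (elim j)
    have "?f j - 1 = q ^ j * (w - z) / (1 - q ^ j * w)"
      using nz[of j] by (simp add: field_simps)
    then have "norm (norm (?f j - 1)) = q ^ j * \<bar>w - z\<bar> / \<bar>1 - q ^ j * w\<bar>"
      using q by (simp add: abs_mult)
    also have "\<dots> \<le> q ^ j * \<bar>w - z\<bar> / (1/2)"
      using elim q by (intro divide_left_mono) auto
    finally show ?case by (simp add: mult_ac)
  qed
  moreover have "summable (\<lambda>j. 2 * \<bar>w - z\<bar> * q ^ j)"
    using q by (intro summable_mult summable_geometric) auto
  ultimately have "summable (\<lambda>j. norm (?f j - 1))"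
    by (rule summable_comparison_test_ev)
  then show ?thesis
    by (intro abs_convergent_prod_imp_convergent_prod)
       (simp add: abs_convergent_prod_conv_summable)
qed

lemma q_poch_ratio_LIMSEQ:
  fixes q z w :: real
  assumes "0 < q" "q < 1" and "\<And>j::nat. 1 - q ^ j * w \<noteq> 0"
  shows "(\<lambda>n. \<Prod>j\<le>n. (1 - q ^ j * z) / (1 - q ^ j * w)) \<longlonglongrightarrow> q_poch_ratio q z w"
  unfolding q_poch_ratio_def
  by (rule convergent_prod_LIMSEQ[OF convergent_q_poch_ratio[OF assms]])

lemma q_poch_ratio_nonzero:
  assumes "0 < q" "q < 1" "\<And>j::nat. 1 - q ^ j * w \<noteq> 0" "\<And>j::nat. 1 - q ^ j * z \<noteq> 0"
  shows "q_poch_ratio q z w \<noteq> 0"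
  unfolding q_poch_ratio_def
  by (rule prodinf_nonzero[OF convergent_q_poch_ratio[OF assms(1-3)]]) (use assms in auto)

text \<open>Shifting all the factors of one side of a finite quotient of products by one index
  drops the first factor and adds a new last one.\<close>

lemma prod_shift_denominator:
  fixes a b :: "nat \<Rightarrow> 'a :: field"
  assumes "\<And>j. b j \<noteq> 0"
  shows "(\<Prod>j\<le>n. a j / b (Suc j)) * b (Suc n) = (\<Prod>j\<le>n. a j / b j) * b 0"
proof (induction n)
  case (Suc n)
  then have "(\<Prod>j\<le>n. a j / b (Suc j)) = (\<Prod>j\<le>n. a j / b j) * b 0 / b (Suc n)"
    using assms[of "Suc n"] by (simp add: eq_divide_eq)
  then show ?case using assms by simp
qed (use assms in simp)

lemma prod_shift_numerator:
  fixes a b :: "nat \<Rightarrow> 'a :: field"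
  shows "(\<Prod>j\<le>n. a j / b j) * a (Suc n) = (\<Prod>j\<le>n. a (Suc j) / b j) * a 0"
proof (induction n)
  case (Suc n)
  then show ?case by (simp add: mult.assoc mult.left_commute)
qed simp

text \<open>In the two shift rules the partial products of the two sides agree up to the last factor,
  $1-q^{n+1}w$ or $1-q^{n+1}z$, which tends to $1$.\<close>

lemma q_poch_ratio_shift_denominator:
  fixes q z w :: real
  assumes q: "0 < q" "q < 1" and nz: "\<And>j::nat. 1 - q ^ j * w \<noteq> 0"
  shows "q_poch_ratio q z (q * w) = q_poch_ratio q z w * (1 - w)"
proof -
  have nz': "1 - q ^ j * (q * w) \<noteq> 0" for j
    using nz[of "Suc j"] by (simp add: mult_ac)
  have partial: "(\<Prod>j\<le>n. (1 - q ^ j * z) / (1 - q ^ j * (q * w))) * (1 - q ^ Suc n * w) =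
      (\<Prod>j\<le>n. (1 - q ^ j * z) / (1 - q ^ j * w)) * (1 - w)" for n
    using prod_shift_denominator[of "\<lambda>j. 1 - q ^ j * w" "\<lambda>j. 1 - q ^ j * z" n] nz
    by (simp add: mult_ac)
  have q_pow0: "(\<lambda>n. q ^ Suc n) \<longlonglongrightarrow> 0"
    using q by (intro LIMSEQ_Suc LIMSEQ_realpow_zero) auto
  have "(\<lambda>n. (\<Prod>j\<le>n. (1 - q ^ j * z) / (1 - q ^ j * (q * w))) * (1 - q ^ Suc n * w))
      \<longlonglongrightarrow> q_poch_ratio q z (q * w) * (1 - 0 * w)"
    by (intro tendsto_intros q_pow0 q_poch_ratio_LIMSEQ q nz')
  moreover have "(\<lambda>n. (\<Prod>j\<le>n. (1 - q ^ j * z) / (1 - q ^ j * w)) * (1 - w))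
      \<longlonglongrightarrow> q_poch_ratio q z w * (1 - w)"
    by (intro tendsto_intros q_poch_ratio_LIMSEQ q nz)
  ultimately show ?thesis
    unfolding partial using LIMSEQ_unique by fastforce
qed

lemma q_poch_ratio_shift_numerator:
  fixes q z w :: real
  assumes q: "0 < q" "q < 1" and nz: "\<And>j::nat. 1 - q ^ j * w \<noteq> 0"
  shows "q_poch_ratio q z w = q_poch_ratio q (q * z) w * (1 - z)"
proof -
  have partial: "(\<Prod>j\<le>n. (1 - q ^ j * z) / (1 - q ^ j * w)) * (1 - q ^ Suc n * z) =
      (\<Prod>j\<le>n. (1 - q ^ j * (q * z)) / (1 - q ^ j * w)) * (1 - z)" for n
    using prod_shift_numerator[of "\<lambda>j. 1 - q ^ j * z" "\<lambda>j. 1 - q ^ j * w" n]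
    by (simp add: mult_ac)
  have q_pow0: "(\<lambda>n. q ^ Suc n) \<longlonglongrightarrow> 0"
    using q by (intro LIMSEQ_Suc LIMSEQ_realpow_zero) auto
  have "(\<lambda>n. (\<Prod>j\<le>n. (1 - q ^ j * z) / (1 - q ^ j * w)) * (1 - q ^ Suc n * z))
      \<longlonglongrightarrow> q_poch_ratio q z w * (1 - 0 * z)"
    by (intro tendsto_intros q_pow0 q_poch_ratio_LIMSEQ q nz)
  moreover have "(\<lambda>n. (\<Prod>j\<le>n. (1 - q ^ j * (q * z)) / (1 - q ^ j * w)) * (1 - z))
      \<longlonglongrightarrow> q_poch_ratio q (q * z) w * (1 - z)"
    by (intro tendsto_intros q_poch_ratio_LIMSEQ q nz)
  ultimately show ?thesis
    unfolding partial using LIMSEQ_unique by fastforce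
qed

section \<open>The operator on polynomials\<close>

lemma q_deriv_poly_eq_sum:
  assumes "0 < q" "q < 1"
  shows "q_deriv q (poly p) x = (\<Sum>k\<le>degree p. q_num q (real k) * coeff p k * x ^ (k - 1))"
proof (cases "x = 0")
  case True
  have "deriv (poly p) 0 = poly (pderiv p) 0"
    by (rule DERIV_imp_deriv) (rule poly_DERIV)
  also have "\<dots> = coeff p 1" by (simp add: poly_0_coeff_0 coeff_pderiv)
  \<comment> \<open>At $x = 0$ only the term $k = 1$ survives: $k = 0$ also has exponent $0$, but $[0]_q = 0$.\<close>
  also have "\<dots> = (\<Sum>k\<le>degree p. if k = 1 then coeff p 1 else 0)"
    by (auto simp: sum.delta coeff_eq_0)
  also have "\<dots> = (\<Sum>k\<le>degree p. q_num q (real k) * coeff p k * 0 ^ (k - 1))"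
    by (rule sum.cong) (use assms in \<open>auto simp: q_num_def power_0_left\<close>)
  finally show ?thesis using True by (simp add: q_deriv_def)
next
  case False
  have "q_num q (real k) * coeff p k * x ^ (k - 1) =
      (coeff p k * (q * x) ^ k - coeff p k * x ^ k) / ((q - 1) * x)" for k
    using False assms
    by (cases k) (simp_all add: q_num_def powr_realpow field_simps del: of_nat_Suc)
  then show ?thesis using False
    by (simp add: q_deriv_def poly_altdef sum_subtractf flip: sum_divide_distrib)
qed

definition q_pderiv :: "real \<Rightarrow> real poly \<Rightarrow> real poly" where
  "q_pderiv q p = (\<Sum>k\<le>degree p. monom (q_num q (real k) * coeff p k) (k - 1))"

lemma poly_q_pderiv:
  assumes "0 < q" "q < 1"
  shows "poly (q_pderiv q p) x = q_deriv q (poly p) x"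
  using assms by (simp add: q_pderiv_def q_deriv_poly_eq_sum poly_sum poly_monom)

lemma coeff_q_pderiv:
  assumes "0 < q"
  shows "coeff (q_pderiv q p) k = q_num q (real (Suc k)) * coeff p (Suc k)"
proof -
  have "coeff (q_pderiv q p) k =
      (\<Sum>i\<le>degree p. if i = Suc k then q_num q (real (Suc k)) * coeff p (Suc k) else 0)"
    unfolding q_pderiv_def coeff_sum
    by (rule sum.cong) (use assms in \<open>auto simp: q_num_def split: nat.splits\<close>)
  also have "\<dots> = q_num q (real (Suc k)) * coeff p (Suc k)"
    by (auto simp: sum.delta coeff_eq_0)
  finally show ?thesis .
qed

text \<open>The cancelled form of $U$, as a polynomial; composition with \<open>monom (1 / q) (Suc 0)\<close>
  is the substitution $x \mapsto x/q$.\<close>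

definition q_op_poly :: "real \<Rightarrow> real \<Rightarrow> real \<Rightarrow> real poly \<Rightarrow> real poly" where
  "q_op_poly q \<alpha> \<beta> p =
     smult (1 / (q - 1))
       (smult (q powr (\<alpha> + 1)) ([:1, -1:] * q_pderiv q p)
        - [:1, - (q powr (-\<beta> - 1)):] * pcompose (q_pderiv q p) (monom (1 / q) (Suc 0)))"

definition q_op_eigenvalue :: "real \<Rightarrow> real \<Rightarrow> real \<Rightarrow> nat \<Rightarrow> real" where
  "q_op_eigenvalue q \<alpha> \<beta> r =
     - (q powr (- \<beta> - real r)) * q_num q (real r) * q_num q (real r + \<alpha> + \<beta> + 1)"

definition q_op_lowering :: "real \<Rightarrow> real \<Rightarrow> nat \<Rightarrow> real" where
  "q_op_lowering q \<alpha> r = q_num q (real r) * q_num q (\<alpha> + real r) / q ^ (r - 1)"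

text \<open>Equivalently, $U x^k = \mu_k x^k + \lambda_k x^{k-1}$. This follows by collecting the powers of
  $x$ in the cancelled form, where $D x^k = [k]_q x^{k-1}$.\<close>

lemma coeff_q_op_poly:
  assumes q: "0 < q" "q < 1"
  shows "coeff (q_op_poly q \<alpha> \<beta> p) k =
    q_op_eigenvalue q \<alpha> \<beta> k * coeff p k + q_op_lowering q \<alpha> (Suc k) * coeff p (Suc k)"
proof (cases k)
  case 0
  have "poly (q_pderiv q p) 0 = coeff p 1"
    using q by (simp add: poly_0_coeff_0 coeff_q_pderiv q_num_def)
  then show ?thesis using q
    by (simp add: 0 q_op_poly_def q_op_eigenvalue_def q_op_lowering_def coeff_q_pderiv
        q_num_def powr_add field_simps coeff_pCons)
next
  case (Suc m)
  have e1: "q powr (- \<beta> - 1) = q powr (-\<beta>) / q"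
    using q by (simp add: powr_diff)
  have e2: "q powr (- \<beta> - real k) = q powr (-\<beta>) / q ^ k"
    using q by (simp add: powr_diff powr_realpow)
  have e3: "q powr (real k + \<alpha> + \<beta> + 1) = q ^ k * q powr \<alpha> / q powr (-\<beta>) * q"
    using q by (simp add: powr_add powr_realpow powr_minus divide_inverse mult_ac)
  have b: "q powr (-\<beta>) > 0" using q by simp
  have e5: "q powr (\<alpha> + real (Suc k)) = q powr \<alpha> * q ^ k * q"
    using q by (simp add: powr_add powr_realpow del: of_nat_Suc)
  have "coeff (q_op_poly q \<alpha> \<beta> p) k =
     (q powr \<alpha> * q * (q_num q (real (Suc k)) * coeff p (Suc k) - q_num q (real k) * coeff p k)
      - q_num q (real (Suc k)) * coeff p (Suc k) / q ^ k
      + q powr (-\<beta>) / q * q_num q (real k) * coeff p k / q ^ m) / (q - 1)"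
    using q by (simp add: Suc q_op_poly_def coeff_q_pderiv powr_add e1 power_one_over
         field_simps del: of_nat_Suc power_Suc)
  also have "\<dots> = ((q powr \<alpha> * q - 1 / q ^ k) * (q_num q (real (Suc k)) * coeff p (Suc k))
      + (q powr (-\<beta>) / q ^ k - q powr \<alpha> * q) * (q_num q (real k) * coeff p k)) / (q - 1)"
    by (simp add: Suc algebra_simps)
  also have "\<dots> = ((q powr \<alpha> * q - 1 / q ^ k) / (q - 1)) * q_num q (real (Suc k)) * coeff p (Suc k)
      + ((q powr (-\<beta>) / q ^ k - q powr \<alpha> * q) / (q - 1)) * q_num q (real k) * coeff p k"
    by (simp add: add_divide_distrib)
  also have "(q powr \<alpha> * q - 1 / q ^ k) / (q - 1) = q_num q (\<alpha> + real (Suc k)) / q ^ k"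
    using q unfolding q_num_def e5 by (simp add: field_simps)
  also have "(q powr (-\<beta>) / q ^ k - q powr \<alpha> * q) / (q - 1) =
      - (q powr (- \<beta> - real k)) * q_num q (real k + \<alpha> + \<beta> + 1)"
    using q b unfolding q_num_def e2 e3 by (simp add: divide_simps) (simp add: algebra_simps)
  finally show ?thesis
    by (simp add: q_op_eigenvalue_def q_op_lowering_def mult_ac)
qed

lemma poly_q_op_poly:
  assumes "0 < q" "q < 1"
  shows "poly (q_op_poly q \<alpha> \<beta> p) x = q_op_cancelled q \<alpha> \<beta> (poly p) x"
proof -
  have "poly (pcompose (q_pderiv q p) (monom (1 / q) (Suc 0))) x = q_deriv q (poly p) (x / q)"
    using assms by (simp add: poly_pcompose poly_monom poly_q_pderiv)
  then show ?thesis using assms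
    by (simp add: q_op_poly_def q_op_cancelled_def poly_q_pderiv left_diff_distrib mult.assoc)
qed

text \<open>With $z = q^{-\beta}x$, all three infinite products that occur are multiples of
  $R = (z;q)_\infty/(x;q)_\infty$: the one in the denominator is $R$ itself, and the two values of
  the differentiated product, at $qx$ and at $x$, are $R(1-x)$ and $R(1-z/q)$.\<close>

lemma q_op_quotient_eq_cancelled:
  assumes q: "0 < q" "q < 1" and x: "x > 0"
    and den: "\<And>j::nat. 1 - q ^ j * x \<noteq> 0"
    and num: "\<And>j::nat. 1 - q powr (real j - \<beta>) * x \<noteq> 0"
  shows "q_op_quotient q \<alpha> \<beta> f x = q_op_cancelled q \<alpha> \<beta> f x"
proof -
  define z where "z = q powr (-\<beta>) * x"
  define R where "R = q_poch_ratio q z x"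
  have num': "1 - q ^ j * z \<noteq> 0" for j
    using num[of j] q by (simp add: z_def powr_diff powr_minus powr_realpow field_simps)
  have R: "R \<noteq> 0" unfolding R_def by (intro q_poch_ratio_nonzero q den num')
  have undo: "q powr \<beta> * z = x"
    using q by (simp add: z_def powr_minus)
  have zq: "q powr (-\<beta> - 1) * x = z / q"
    using q by (simp add: z_def powr_diff)
  have denom: "q_pow q \<beta> (q powr (-\<beta>) * x) = R"
    using q by (simp add: q_pow_eq_q_poch_ratio z_def[symmetric] undo R_def)
  have at_x: "q_pow q (\<beta> + 1) (q powr (-\<beta> - 1) * x) = R * (1 - q powr (-\<beta> - 1) * x)"
  proof -
    have "q_pow q (\<beta> + 1) (z / q) = q_poch_ratio q (z / q) x"
      using q by (simp add: q_pow_eq_q_poch_ratio powr_add undo)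
    also have "\<dots> = R * (1 - z / q)"
      using q_poch_ratio_shift_numerator[OF q den, of "z / q"] q by (simp add: R_def)
    finally show ?thesis by (simp add: zq)
  qed
  have at_qx: "q_pow q (\<beta> + 1) (q powr (-\<beta> - 1) * (q * x)) = R * (1 - x)"
  proof -
    have "q powr (-\<beta> - 1) * (q * x) = z" using q zq by (simp add: field_simps)
    then have "q_pow q (\<beta> + 1) (q powr (-\<beta> - 1) * (q * x)) = q_poch_ratio q z (q * x)"
      using q undo by (simp add: q_pow_eq_q_poch_ratio powr_add mult_ac)
    also have "\<dots> = R * (1 - x)"
      unfolding R_def by (rule q_poch_ratio_shift_denominator[OF q den])
    finally show ?thesis .
  qed
  have "q_op_quotient q \<alpha> \<beta> f x =
     (((q * x) powr (\<alpha> + 1) * (R * (1 - x)) * q_deriv q f x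
       - x powr (\<alpha> + 1) * (R * (1 - q powr (-\<beta> - 1) * x)) * q_deriv q f (x / q)) / ((q - 1) * x))
     / (x powr \<alpha> * R)"
    using x q unfolding q_op_quotient_def denom
    by (subst q_deriv_def) (simp add: at_x at_qx)
  also have "\<dots> = q_op_cancelled q \<alpha> \<beta> f x"
  proof -
    have "(q * x) powr (\<alpha> + 1) = q powr (\<alpha> + 1) * (x powr \<alpha> * x)" "x powr (\<alpha> + 1) = x powr \<alpha> * x"
      using x q by (simp_all add: powr_mult powr_add)
    moreover have "x powr \<alpha> > 0" using x by simp
    ultimately show ?thesis
      using x q R unfolding q_op_cancelled_def by (simp add: divide_simps) (simp add: algebra_simps)
  qed
  finally show ?thesis .
qed

lemma q_op_poly_correct:
  assumes "0 < q" "q < 1"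
  shows "q_op q \<alpha> \<beta> (poly p) = poly (q_op_poly q \<alpha> \<beta> p)"
  using assms q_op_quotient_eq_cancelled[OF assms]
  by (auto simp: q_op_def poly_q_op_poly)

section \<open>The inner product on polynomials\<close>

locale little_q_jacobi =
  fixes q \<alpha> \<beta> :: real
  assumes q: "0 < q" "q < 1" and \<alpha>: "\<alpha> > -1" and \<beta>: "\<beta> > -1"
begin

definition node :: "nat \<Rightarrow> real" where
  "node i = q ^ i * q powr (\<beta> + 1)"

definition weight :: "nat \<Rightarrow> real" where
  "weight i = q ^ i * q powr (real i * \<alpha>) * q_pow q \<beta> (q ^ (i + 1))"

text \<open>The inner product without its positive constant factor.\<close>

definition ip :: "real poly \<Rightarrow> real poly \<Rightarrow> real" where
  "ip f g = (\<Sum>i. weight i * poly f (node i) * poly g (node i))"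

lemma q_inner_poly:
  "q_inner q \<alpha> \<beta> (poly f) (poly g) = q powr ((\<alpha> + 1) * (\<beta> + 1)) * (1 - q) * ip f g"
proof -
  have "q powr (real i + \<beta> + 1) = node i" for i
    using q by (simp add: node_def powr_add powr_realpow mult.assoc)
  then show ?thesis by (simp add: q_inner_def ip_def weight_def)
qed

lemma q_inner_poly_eq_0_iff: "q_inner q \<alpha> \<beta> (poly f) (poly g) = 0 \<longleftrightarrow> ip f g = 0"
  using q by (simp add: q_inner_poly)

lemma q_powr_less_1: "a > 0 \<Longrightarrow> q powr a < 1"
  using powr_less_mono'[of q 0 a] q by simp

lemma denominator_pos: "1 - q ^ j * (q powr \<beta> * q ^ Suc i) > 0"
proof -
  have "q ^ j * (q powr \<beta> * q ^ Suc i) = q powr (real (Suc (i + j)) + \<beta>)"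
    using q by (simp add: powr_add powr_realpow power_add del: of_nat_Suc)
  also have "\<dots> < 1" using \<beta> by (intro q_powr_less_1) auto
  finally show ?thesis by simp
qed

lemma numerator_pos: "1 - q ^ j * q ^ Suc i > 0"
  using q power_Suc_less_one[of q "j + i"] by (simp add: power_add mult_ac)

lemma weight_pos: "weight i > 0"
proof -
  have "q_pow q \<beta> (q ^ Suc i) > 0"
    unfolding q_pow_eq_q_poch_ratio[OF q(1)] q_poch_ratio_def
    using denominator_pos numerator_pos
    by (intro less_0_prodinf convergent_q_poch_ratio q divide_pos_pos) (auto simp: less_imp_neq[symmetric])
  then show ?thesis using q by (simp add: weight_def)
qed

text \<open>The $q$-analogue of the Pearson equation of the Jacobi weight, which puts $U$ into
  divergence form. Passing from $i$ to $i+1$ multiplies both arguments of the quotient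
  $(z;q)_\infty/(w;q)_\infty$ in the weight by $q$, so each shift rule applies once.\<close>

lemma weight_Suc:
  "weight (Suc i) * (1 - q ^ Suc i) = weight i * (q powr (\<alpha> + 1) * (1 - node i))"
proof -
  let ?w = "q powr \<beta> * q ^ Suc i"
  have nz: "1 - q ^ j * ?w \<noteq> 0" for j using denominator_pos[of j i] by simp
  have nz': "1 - q ^ j * (q * ?w) \<noteq> 0" for j
    using denominator_pos[of j "Suc i"] by (simp add: mult_ac)
  have "q_pow q \<beta> (q ^ Suc (Suc i)) * (1 - q ^ Suc i)
      = q_poch_ratio q (q * q ^ Suc i) (q * ?w) * (1 - q ^ Suc i)"
    using q by (simp add: q_pow_eq_q_poch_ratio mult_ac)
  also have "\<dots> = q_poch_ratio q (q ^ Suc i) (q * ?w)"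
    by (rule q_poch_ratio_shift_numerator[OF q nz', symmetric])
  also have "\<dots> = q_poch_ratio q (q ^ Suc i) ?w * (1 - ?w)"
    by (rule q_poch_ratio_shift_denominator[OF q nz])
  also have "\<dots> = q_pow q \<beta> (q ^ Suc i) * (1 - node i)"
    using q by (simp add: q_pow_eq_q_poch_ratio node_def powr_add mult_ac)
  finally have "q_pow q \<beta> (q ^ Suc (Suc i)) * (1 - q ^ Suc i) = q_pow q \<beta> (q ^ Suc i) * (1 - node i)" .
  moreover have "q powr (real (Suc i) * \<alpha>) = q powr (real i * \<alpha>) * q powr \<alpha>"
    by (simp add: powr_add distrib_right)
  moreover have "q powr (\<alpha> + 1) = q powr \<alpha> * q"
    using q by (simp add: powr_add)
  ultimately show ?thesis
    by (simp add: weight_def del: power_Suc of_nat_Suc) (simp add: mult_ac)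
qed

lemma node_pos: "node i > 0"
  using q by (simp add: node_def)

lemma node_LIMSEQ: "node \<longlonglongrightarrow> 0"
proof -
  have "(\<lambda>i. q ^ i * q powr (\<beta> + 1)) \<longlonglongrightarrow> 0 * q powr (\<beta> + 1)"
    using q by (intro tendsto_intros LIMSEQ_realpow_zero) auto
  then show ?thesis by (simp add: node_def[abs_def])
qed

lemma poly_node_LIMSEQ: "(\<lambda>i. poly f (node i)) \<longlonglongrightarrow> poly f 0"
  by (intro tendsto_intros node_LIMSEQ)

lemma inj_node: "inj node"
proof (rule injI)
  fix i j assume "node i = node j"
  then have "q ^ i = q ^ j" using q by (simp add: node_def)
  then show "i = j" using q power_inject_exp'[of q i j] by simp
qed

text \<open>Ratio test: the quotient of consecutive weights tends to $q^{\alpha+1} < 1$.\<close>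

lemma summable_weight: "summable weight"
proof -
  define L where "L = q powr (\<alpha> + 1)"
  have L: "L < 1" using \<alpha> by (simp add: L_def q_powr_less_1)
  have q_pow0: "(\<lambda>i. q ^ Suc i) \<longlonglongrightarrow> 0"
    using q by (intro LIMSEQ_Suc LIMSEQ_realpow_zero) auto
  have "(\<lambda>i. L * (1 - node i) / (1 - q ^ Suc i)) \<longlonglongrightarrow> L * (1 - 0) / (1 - 0)"
    by (intro tendsto_intros node_LIMSEQ q_pow0) simp
  moreover obtain c where c: "L < c" "c < 1" using L dense by blast
  ultimately have "\<forall>\<^sub>F i in sequentially. L * (1 - node i) / (1 - q ^ Suc i) < c"
    by (intro order_tendstoD) auto
  then obtain N where N: "L * (1 - node i) / (1 - q ^ Suc i) < c" if "i \<ge> N" for i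
    by (auto simp: eventually_sequentially)
  show ?thesis
  proof (rule summable_ratio_test)
    show "c < 1" by (fact c)
    fix i assume "i \<ge> N"
    have "weight (Suc i) = weight i * (L * (1 - node i) / (1 - q ^ Suc i))"
      using weight_Suc[of i] numerator_pos[of 0 i] by (simp add: L_def eq_divide_eq)
    also have "\<dots> \<le> weight i * c"
      using N[OF \<open>i \<ge> N\<close>] weight_pos[of i] by (intro mult_left_mono) auto
    finally show "norm (weight (Suc i)) \<le> c * norm (weight i)"
      using weight_pos[of i] weight_pos[of "Suc i"] by (simp add: mult.commute)
  qed
qed

lemma summable_weight_poly: "summable (\<lambda>i. weight i * poly f (node i))"
proof -
  obtain B where B: "\<And>i. norm (poly f (node i)) \<le> B"
    using convergent_imp_Bseq[OF convergentI[OF poly_node_LIMSEQ]] by (auto simp: Bseq_def)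
  show ?thesis
  proof (rule summable_comparison_test')
    show "summable (\<lambda>i. weight i * B)" by (rule summable_mult2[OF summable_weight])
    show "norm (weight i * poly f (node i)) \<le> weight i * B" if "i \<ge> 0" for i
      using B[of i] weight_pos[of i] by (simp add: abs_mult mult_left_mono)
  qed
qed

lemma summable_ip: "summable (\<lambda>i. weight i * poly f (node i) * poly g (node i))"
  using summable_weight_poly[of "f * g"] by (simp add: mult.assoc)

lemma ip_diff_left: "ip (f - g) h = ip f h - ip g h"
  by (simp add: ip_def suminf_diff[OF summable_ip summable_ip] left_diff_distrib right_diff_distrib)

lemma ip_smult_left: "ip (smult c f) h = c * ip f h"
  using suminf_mult[OF summable_ip[of f h], of c] by (simp add: ip_def mult_ac)

lemma ip_commute: "ip f g = ip g f"
  by (simp add: ip_def mult_ac)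

lemma ip_diff_right: "ip h (f - g) = ip h f - ip h g"
  by (metis ip_commute ip_diff_left)

lemma ip_smult_right: "ip h (smult c f) = c * ip h f"
  by (metis ip_commute ip_smult_left)

lemma ip_zero_right [simp]: "ip f 0 = 0"
  by (simp add: ip_def)

text \<open>A polynomial of norm zero vanishes at the infinitely many nodes.\<close>

lemma ip_definite:
  assumes "ip f f = 0"
  shows "f = 0"
proof (rule ccontr)
  assume "f \<noteq> 0"
  have nonneg: "weight i * poly f (node i) * poly f (node i) \<ge> 0" for i
    using weight_pos[of i] by (simp add: mult.assoc)
  have "weight i * poly f (node i) * poly f (node i) = 0" for i
    using assms suminf_eq_zero_iff[OF summable_ip nonneg] by (simp add: ip_def)
  then have "poly f (node i) = 0" for i
    using weight_pos[of i] by (metis less_irrefl mult_eq_0_iff)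
  then have "range node \<subseteq> {x. poly f x = 0}" by auto
  then have "finite (range node)"
    using poly_roots_finite[OF \<open>f \<noteq> 0\<close>] finite_subset by blast
  then show False using inj_node range_inj_infinite by blast
qed

section \<open>Self-adjointness\<close>

text \<open>The quantity whose backward difference is the weighted value of $Uf$ at a node.\<close>

definition flux :: "real poly \<Rightarrow> nat \<Rightarrow> real" where
  "flux f i = q powr (\<alpha> + 1) * (1 - node i) * weight i * poly (q_pderiv q f) (node i) / (q - 1)"

lemma flux_eq_difference:
  "flux f i = q powr (\<alpha> + 1) * (1 - node i) * weight i / ((q - 1)\<^sup>2 * node i) *
    (poly f (node (Suc i)) - poly f (node i))"
proof -
  have "q * node i = node (Suc i)" by (simp add: node_def)
  then have "poly (q_pderiv q f) (node i) =
      (poly f (node (Suc i)) - poly f (node i)) / ((q - 1) * node i)"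
    using q node_pos[of i] by (simp add: poly_q_pderiv q_deriv_def)
  then show ?thesis by (simp add: flux_def power2_eq_square)
qed

lemma weight_q_op_poly:
  "weight i * poly (q_op_poly q \<alpha> \<beta> f) (node i) = flux f i -
    weight i * (1 - q ^ i) * poly (q_pderiv q f) (node i / q) / (q - 1)"
proof -
  have "q powr (- \<beta> - 1) * node i = q ^ i"
    using q by (simp add: node_def powr_diff powr_add powr_minus)
  then show ?thesis
    using q by (simp add: poly_q_op_poly q_op_cancelled_def poly_q_pderiv flux_def
      diff_divide_distrib right_diff_distrib mult_ac)
qed

text \<open>There is no flux into the first node, because of the factor $1-q^0$.\<close>

lemma weight_q_op_poly_0: "weight 0 * poly (q_op_poly q \<alpha> \<beta> f) (node 0) = flux f 0"
  by (simp add: weight_q_op_poly)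

lemma weight_q_op_poly_Suc:
  "weight (Suc i) * poly (q_op_poly q \<alpha> \<beta> f) (node (Suc i)) = flux f (Suc i) - flux f i"
proof -
  have "node (Suc i) / q = node i" using q by (simp add: node_def)
  then show ?thesis
    unfolding weight_q_op_poly weight_Suc by (simp add: flux_def mult_ac)
qed

text \<open>Summation by parts for both orders of $f$ and $g$ at once. The flux of $f$ is a multiple,
  independent of $f$, of the first difference of $f$. The interior terms are therefore symmetric
  in $f$ and $g$ and cancel, and a discrete Wronskian at the last node remains.\<close>

lemma lagrange_identity:
  "(\<Sum>i\<le>n. weight i * poly (q_op_poly q \<alpha> \<beta> f) (node i) * poly g (node i)
         - weight i * poly f (node i) * poly (q_op_poly q \<alpha> \<beta> g) (node i)) =
   flux f n * poly g (node n) - flux g n * poly f (node n)"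
proof (induction n)
  case 0
  show ?case
    using weight_q_op_poly_0[of f] weight_q_op_poly_0[of g] by (simp add: mult_ac)
next
  case (Suc n)
  have "flux f n * (poly g (node (Suc n)) - poly g (node n)) =
        flux g n * (poly f (node (Suc n)) - poly f (node n))"
    unfolding flux_eq_difference by (simp add: mult_ac)
  moreover have "weight (Suc n) * poly f (node (Suc n)) * poly (q_op_poly q \<alpha> \<beta> g) (node (Suc n))
      = (flux g (Suc n) - flux g n) * poly f (node (Suc n))"
    unfolding weight_q_op_poly_Suc[symmetric] by (simp add: mult_ac)
  ultimately show ?case
    using Suc by (simp add: weight_q_op_poly_Suc left_diff_distrib right_diff_distrib)
qed

lemma flux_LIMSEQ: "flux f \<longlonglongrightarrow> 0"
proof -
  have "(\<lambda>i. q powr (\<alpha> + 1) * (1 - node i) * weight i * poly (q_pderiv q f) (node i) / (q - 1))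
     \<longlonglongrightarrow> q powr (\<alpha> + 1) * (1 - 0) * 0 * poly (q_pderiv q f) 0 / (q - 1)"
    using q by (intro tendsto_intros node_LIMSEQ summable_LIMSEQ_zero[OF summable_weight]) auto
  then show ?thesis by (simp add: flux_def[abs_def])
qed

lemma ip_q_op_poly_self_adjoint: "ip (q_op_poly q \<alpha> \<beta> f) g = ip f (q_op_poly q \<alpha> \<beta> g)"
proof -
  let ?d = "\<lambda>i. weight i * poly (q_op_poly q \<alpha> \<beta> f) (node i) * poly g (node i)
         - weight i * poly f (node i) * poly (q_op_poly q \<alpha> \<beta> g) (node i)"
  have "(\<lambda>n. \<Sum>i\<le>n. ?d i) \<longlonglongrightarrow> 0 * poly g 0 - 0 * poly f 0"
    unfolding lagrange_identity by (intro tendsto_intros flux_LIMSEQ node_LIMSEQ)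
  then have "?d sums 0" by (simp add: sums_def_le)
  then have "suminf ?d = 0" by (simp add: sums_iff)
  then show ?thesis
    by (simp add: ip_def suminf_diff[OF summable_ip summable_ip, symmetric])
qed

section \<open>The orthogonal polynomials\<close>

lemma q_num_pos: "a > 0 \<Longrightarrow> q_num q a > 0"
  using q q_powr_less_1[of a] by (simp add: q_num_def)

lemma q_op_lowering_nonzero: "q_op_lowering q \<alpha> (Suc k) \<noteq> 0"
proof -
  have "q_num q (real (Suc k)) > 0" "q_num q (\<alpha> + real (Suc k)) > 0"
    using \<alpha> by (auto intro!: q_num_pos)
  then show ?thesis using q by (simp add: q_op_lowering_def)
qed

text \<open>$\mu_k = -(1-q^k)(q^{-\beta-k}-q^{\alpha+1})/(1-q)^2$, where both factors increase with
  $k$, and both are positive for $k \ge 1$, while the first vanishes at $k = 0$.\<close>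

lemma q_op_eigenvalue_strict_antimono:
  assumes "i < j"
  shows "q_op_eigenvalue q \<alpha> \<beta> j < q_op_eigenvalue q \<alpha> \<beta> i"
proof -
  define u where "u k = 1 - q ^ k" for k :: nat
  define v where "v k = q powr (-\<beta> - real k) - q powr (\<alpha> + 1)" for k :: nat
  have eig: "q_op_eigenvalue q \<alpha> \<beta> k = - (u k * v k / (1 - q)\<^sup>2)" for k
  proof -
    have "q powr (-\<beta> - real k) * q powr (real k + \<alpha> + \<beta> + 1) = q powr (\<alpha> + 1)"
      by (simp flip: powr_add)
    then have "q powr (-\<beta> - real k) * (1 - q powr (real k + \<alpha> + \<beta> + 1)) = v k"
      by (simp add: v_def right_diff_distrib)
    then have "q_op_eigenvalue q \<alpha> \<beta> k = - (u k * (v k)) / (1 - q)\<^sup>2"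
      using q by (simp add: q_op_eigenvalue_def q_num_def u_def powr_realpow power2_eq_square mult_ac)
    then show ?thesis by simp
  qed
  have "u i < u j" using assms q by (simp add: u_def)
  moreover have "u i \<ge> 0" using q by (simp add: u_def power_le_one)
  moreover have "v i < v j" using assms q powr_less_mono'[of q "-\<beta> - real j" "-\<beta> - real i"] by (simp add: v_def)
  moreover have "v j > 0"
    using assms q \<alpha> \<beta> powr_less_mono'[of q "-\<beta> - real j" "\<alpha> + 1"] by (simp add: v_def)
  ultimately have "u i * v i < u j * v j"
    by (smt (verit) mult_left_mono mult_strict_right_mono)
  then show ?thesis
    using q unfolding eig by (simp add: divide_strict_right_mono)
qed

lemma q_op_eigenvalue_inj: "i \<noteq> j \<Longrightarrow> q_op_eigenvalue q \<alpha> \<beta> i \<noteq> q_op_eigenvalue q \<alpha> \<beta> j"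
  using q_op_eigenvalue_strict_antimono[of i j] q_op_eigenvalue_strict_antimono[of j i]
  by (cases i j rule: linorder_cases) auto

definition value_at_0 :: "nat \<Rightarrow> real" where
  "value_at_0 r = (\<Prod>j = 1..r. q_num q (\<alpha> + real j)) / q_fact q r"

lemma value_at_0_nonzero: "value_at_0 r \<noteq> 0"
proof -
  have "(\<Prod>j = 1..r. q_num q (\<alpha> + real j)) > 0" "q_fact q r > 0"
    unfolding q_fact_def using \<alpha> by (auto intro!: prod_pos q_num_pos)
  then show ?thesis unfolding value_at_0_def by (metis divide_pos_pos less_irrefl)
qed

text \<open>As $U$ is bidiagonal, $Up = \mu_r p$ is a two-term recurrence for the coefficients of $p$. It can
  be solved upwards from the prescribed constant term, and it stops at degree $r$ because the factor
  $\mu_r-\mu_j$ vanishes at $j = r$, and at no other $j$.\<close>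

definition eigen_coeff :: "nat \<Rightarrow> nat \<Rightarrow> real" where
  "eigen_coeff r k = value_at_0 r *
     (\<Prod>j<k. (q_op_eigenvalue q \<alpha> \<beta> r - q_op_eigenvalue q \<alpha> \<beta> j) / q_op_lowering q \<alpha> (Suc j))"

definition eigen_poly :: "nat \<Rightarrow> real poly" where
  "eigen_poly r = (\<Sum>k\<le>r. monom (eigen_coeff r k) k)"

lemma coeff_eigen_poly: "coeff (eigen_poly r) k = eigen_coeff r k"
proof -
  have "eigen_coeff r k = 0" if "k > r"
    using that by (auto simp: eigen_coeff_def)
  then show ?thesis by (auto simp: eigen_poly_def coeff_sum not_le)
qed

lemma degree_eigen_poly: "degree (eigen_poly r) = r"
proof (rule antisym)
  show "degree (eigen_poly r) \<le> r"
    by (rule degree_le) (auto simp: coeff_eigen_poly eigen_coeff_def)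
  have "eigen_coeff r r \<noteq> 0"
    using value_at_0_nonzero q_op_lowering_nonzero q_op_eigenvalue_inj[of r]
    by (auto simp: eigen_coeff_def)
  then show "r \<le> degree (eigen_poly r)"
    by (intro le_degree) (simp add: coeff_eigen_poly)
qed

lemma poly_eigen_poly_0: "poly (eigen_poly r) 0 = value_at_0 r"
  by (simp add: poly_0_coeff_0 coeff_eigen_poly eigen_coeff_def)

lemma q_op_poly_eigen_poly:
  "q_op_poly q \<alpha> \<beta> (eigen_poly r) = smult (q_op_eigenvalue q \<alpha> \<beta> r) (eigen_poly r)"
  by (rule poly_eqI)
     (use q q_op_lowering_nonzero in \<open>simp add: coeff_q_op_poly coeff_eigen_poly eigen_coeff_def field_simps\<close>)

lemma is_q_orth_seq_eigen_poly: "is_q_orth_seq q \<alpha> \<beta> eigen_poly"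
proof -
  have "ip (eigen_poly r) (eigen_poly s) = 0" if "r \<noteq> s" for r s
  proof -
    have "q_op_eigenvalue q \<alpha> \<beta> r * ip (eigen_poly r) (eigen_poly s) =
          q_op_eigenvalue q \<alpha> \<beta> s * ip (eigen_poly r) (eigen_poly s)"
      using ip_q_op_poly_self_adjoint[of "eigen_poly r" "eigen_poly s"]
      by (simp add: q_op_poly_eigen_poly ip_smult_left ip_smult_right)
    then show ?thesis using q_op_eigenvalue_inj[OF that] by simp
  qed
  then show ?thesis
    by (simp add: is_q_orth_seq_def q_inner_poly_eq_0_iff degree_eigen_poly
      poly_eigen_poly_0 value_at_0_def)
qed

text \<open>The polynomial $f$ is a combination of the members of degree below $n$; the induction
  subtracts a multiple of \<open>P n\<close> that removes the leading term. The degree bound is expressed by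
  coefficients so that $n = 0$ stands for $f = 0$.\<close>

lemma orth_seq_orth_lower_degree:
  assumes P: "is_q_orth_seq q \<alpha> \<beta> P" and "n \<le> r" "\<And>k. k \<ge> n \<Longrightarrow> coeff f k = 0"
  shows "ip (P r) f = 0"
  using assms(2,3)
proof (induction n arbitrary: f)
  case 0
  then have "f = 0" by (intro poly_eqI) simp
  then show ?case by simp
next
  case (Suc n)
  define c where "c = coeff f n / coeff (P n) n"
  have deg: "degree (P n) = n" and "ip (P r) (P n) = 0"
    using P Suc.prems(1) by (auto simp: is_q_orth_seq_def q_inner_poly_eq_0_iff)
  have "poly (P n) 0 = value_at_0 n"
    using P by (auto simp: is_q_orth_seq_def value_at_0_def)
  then have "P n \<noteq> 0" using value_at_0_nonzero[of n] by auto
  then have lead: "coeff (P n) n \<noteq> 0" using deg leading_coeff_0_iff[of "P n"] by simp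
  have "coeff (f - smult c (P n)) k = 0" if "k \<ge> n" for k
  proof (cases "k = n")
    case True
    then show ?thesis using lead by (simp add: c_def)
  next
    case False
    then show ?thesis using that Suc.prems(2)[of k] deg by (simp add: coeff_eq_0)
  qed
  then have "ip (P r) (f - smult c (P n)) = 0"
    using Suc.prems(1) by (intro Suc.IH) auto
  then show ?case
    using \<open>ip (P r) (P n) = 0\<close> by (simp add: ip_diff_right ip_smult_right)
qed

text \<open>If the multiple $c P_r$ has the leading coefficient of $Q_r$, then $h = Q_r - cP_r$ has degree
  below $r$. So $h$ is orthogonal to $P_r$ and $Q_r$, hence to itself, and $h = 0$; the value at
  $0$ gives $c = 1$.\<close>

lemma orth_seq_unique:
  assumes P: "is_q_orth_seq q \<alpha> \<beta> P" and Q: "is_q_orth_seq q \<alpha> \<beta> Q"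
  shows "P = Q"
proof
  fix r
  have deg: "degree (P r) = r" "degree (Q r) = r"
    and at0: "poly (P r) 0 = value_at_0 r" "poly (Q r) 0 = value_at_0 r"
    using P Q by (auto simp: is_q_orth_seq_def value_at_0_def)
  have "P r \<noteq> 0" using at0 value_at_0_nonzero[of r] by auto
  then have lead: "coeff (P r) r \<noteq> 0" using deg(1) leading_coeff_0_iff[of "P r"] by simp
  define c where "c = coeff (Q r) r / coeff (P r) r"
  define h where "h = Q r - smult c (P r)"
  have low: "coeff h k = 0" if "k \<ge> r" for k
    using that lead deg by (cases "k = r") (auto simp: h_def c_def coeff_eq_0)
  have "ip h h = ip (Q r) h - c * ip (P r) h"
    unfolding h_def by (simp only: ip_diff_left ip_smult_left)
  also have "\<dots> = 0"
    using orth_seq_orth_lower_degree[OF P order.refl low]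
      orth_seq_orth_lower_degree[OF Q order.refl low] by simp
  finally have "Q r = smult c (P r)" using ip_definite[of h] by (simp add: h_def)
  moreover from this have "c = 1" using at0 value_at_0_nonzero[of r] by simp
  ultimately show "P r = Q r" by simp
qed

lemma q_orth_poly_eq_eigen_poly: "q_orth_poly q \<alpha> \<beta> = eigen_poly"
  unfolding q_orth_poly_def
  by (rule the_equality[where P = "is_q_orth_seq q \<alpha> \<beta>", OF is_q_orth_seq_eigen_poly])
     (erule orth_seq_unique[OF _ is_q_orth_seq_eigen_poly])

end

theorem proposition3:
  fixes q \<alpha> \<beta> :: real
  assumes "0 < q" and "q < 1" and "\<alpha> > -1" and "\<beta> > -1"
  shows "(\<forall>f g :: real poly.
            q_inner q \<alpha> \<beta> (q_op q \<alpha> \<beta> (poly f)) (poly g) =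
            q_inner q \<alpha> \<beta> (poly f) (q_op q \<alpha> \<beta> (poly g))) \<and>
         (\<forall>r :: nat. \<forall>f :: real poly. degree f \<le> r \<longrightarrow>
            (\<exists>g :: real poly. degree g \<le> r \<and> q_op q \<alpha> \<beta> (poly f) = poly g)) \<and>
         (\<forall>r :: nat. q_orth_poly q \<alpha> \<beta> r \<noteq> 0 \<and>
            q_op q \<alpha> \<beta> (poly (q_orth_poly q \<alpha> \<beta> r)) =
              (\<lambda>x. - (q powr (- \<beta> - real r)) * q_num q (real r) * q_num q (real r + \<alpha> + \<beta> + 1)
                     * poly (q_orth_poly q \<alpha> \<beta> r) x))"
proof -
  interpret little_q_jacobi q \<alpha> \<beta> using assms by unfold_locales
  have op: "q_op q \<alpha> \<beta> (poly f) = poly (q_op_poly q \<alpha> \<beta> f)" for f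
    by (rule q_op_poly_correct[OF q])
  show ?thesis
  proof (intro conjI allI impI)
    show "q_inner q \<alpha> \<beta> (q_op q \<alpha> \<beta> (poly f)) (poly g) =
          q_inner q \<alpha> \<beta> (poly f) (q_op q \<alpha> \<beta> (poly g))" for f g
      unfolding op q_inner_poly ip_q_op_poly_self_adjoint ..
  next
    fix r :: nat and f :: "real poly" assume "degree f \<le> r"
    then have "degree (q_op_poly q \<alpha> \<beta> f) \<le> r"
      using q by (intro degree_le) (simp add: coeff_q_op_poly coeff_eq_0)
    then show "\<exists>g. degree g \<le> r \<and> q_op q \<alpha> \<beta> (poly f) = poly g"
      using op by blast
  next
    fix r :: nat
    have "poly (eigen_poly r) 0 \<noteq> 0"
      by (simp add: poly_eigen_poly_0 value_at_0_nonzero)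
    then show "q_orth_poly q \<alpha> \<beta> r \<noteq> 0" by (auto simp: q_orth_poly_eq_eigen_poly)
    show "q_op q \<alpha> \<beta> (poly (q_orth_poly q \<alpha> \<beta> r)) =
        (\<lambda>x. - (q powr (- \<beta> - real r)) * q_num q (real r) * q_num q (real r + \<alpha> + \<beta> + 1)
               * poly (q_orth_poly q \<alpha> \<beta> r) x)"
      unfolding op q_orth_poly_eq_eigen_poly q_op_poly_eigen_poly
      by (simp add: fun_eq_iff q_op_eigenvalue_def)
  qed
qed

end
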